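(* Let $n\ge1$, let $m=(m_0,\dots,m_n)$ be a sequence of non-negative integers giving the labeling of $\mathcal{G}^z_n$, and weight the edges of $\mathcal{G}^z_n$ as follows: $a_0$ is the left edge of $T_1$; for $1\le k\le n-1$, $a_k$ is the edge shared by $T_k$ and $T_{k+1}$; for odd $k$, $b_k$ is the bottom edge and $c_k$ the right edge of $T_k$; for even $k$, $b_k$ is the left edge and $c_k$ the top edge of $T_k$; $a_n$ is the remaining edge of $T_n$. Define \[ X = U_{m_0}(b_1)\,T_{m_0,m_1}(a_0c_1)\,U_{m_1}(a_1)\prod_{k=2}^n W_{m_{k-1}}(b_k)\,T_{m_{k-1},m_k}(b_k^{-1}c_k)\,U_{m_k}(a_k), \] the product taken in left-to-right order of increasing $k$. Then for all $1\le i\le m_0+1$, $1\le j\le m_n+1$, $X_{ij}$ equals the sum of $\mathrm{wt}(\omega)$ over all mixed dimer covers $\omega$ of $\mathcal{G}^z_n$ with labeling $(m_0+1-i,m_1,\dots,m_{n-1},m_n+1-j)$, where $\mathrm{wt}(\omega)=\prod_e(\text{weight of }e)^{\omega(e)}$.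
   Context: Mixed dimer covers: for a finite graph $\mathcal{G}=(V,E)$ and $\mathbf{n}\colon V\to\mathbb{N}$, a mixed dimer cover is $\omega\colon E\to\mathbb{N}$ with $\sum_{e\ni v}\omega(e)=\mathbf{n}(v)$ for all $v$. Zigzag snake graph $\mathcal{G}^z_n$: union of unit squares $T_1,\dots,T_n$ with $T_{2j+1}$ having lower-left corner $(j,j)$ and $T_{2j}$ having lower-left corner $(j-1,j)$; vertices are lattice points on the tiles, edges unit sides. Vertices are partitioned into pairs $P_0,\dots,P_n$: for $1\le k\le n$, if $k=2j+1$ then $P_{k-1}=\{(j,j),(j+1,j)\}$, if $k=2j$ then $P_{k-1}=\{(j-1,j),(j-1,j+1)\}$; $P_n$ is the remaining two vertices; the labeling $(x_0,\dots,x_n)$ gives both vertices of $P_i$ the value $x_i$. $U_N(t)$ is the $(N+1)\times(N+1)$ matrix with $(i,j)$-entry $t^{N+2-i-j}$ if $i+j\le N+2$ and $0$ otherwise; $T_{a,b}(t)$ is the $(a+1)\times(b+1)$ matrix with $(i,i)$-entry $t^{i-1}$ and other entries $0$; $W_N(t)$ is the $(N+1)\times(N+1)$ matrix whose $(i,N+2-i)$-entry is $t^N$ for each $i$ and all other entries $0$. *)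

theory Defs
  imports "Jordan_Normal_Form.Matrix" "HOL-Library.FuncSet"
begin

text \<open>Edges are sets of endpoints. Covers are functions on the edge set, hence extensional outside
  it, so that a cover is counted only once.\<close>

definition mixed_dimer_covers :: "'v set \<Rightarrow> 'v set set \<Rightarrow> ('v \<Rightarrow> nat) \<Rightarrow> ('v set \<Rightarrow> nat) set" where
  "mixed_dimer_covers V E lab =
     {\<omega> \<in> E \<rightarrow>\<^sub>E UNIV. \<forall>v\<in>V. (\<Sum>e\<in>{e \<in> E. v \<in> e}. \<omega> e) = lab v}"

definition cover_weight :: "'v set set \<Rightarrow> ('v set \<Rightarrow> 'a::comm_monoid_mult) \<Rightarrow> ('v set \<Rightarrow> nat) \<Rightarrow> 'a" where
  "cover_weight E w \<omega> = (\<Prod>e\<in>E. w e ^ \<omega> e)"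

lemma finite_mixed_dimer_covers:
  assumes "finite E" and meets: "\<And>e. e \<in> E \<Longrightarrow> e \<inter> V \<noteq> {}"
  shows "finite (mixed_dimer_covers V E lab)"
proof -
  have "\<forall>e\<in>E. \<exists>v. v \<in> e \<inter> V" using meets by blast
  then obtain f where f: "\<And>e. e \<in> E \<Longrightarrow> f e \<in> e \<inter> V" by metis
  have "mixed_dimer_covers V E lab \<subseteq> (\<Pi>\<^sub>E e\<in>E. {..lab (f e)})"
  proof
    fix \<omega> assume \<omega>: "\<omega> \<in> mixed_dimer_covers V E lab"
    have "\<omega> e \<le> lab (f e)" if e: "e \<in> E" for e
    proof -
      have "\<omega> e \<le> (\<Sum>e'\<in>{e' \<in> E. f e \<in> e'}. \<omega> e')"
        by (rule member_le_sum) (use e f[OF e] \<open>finite E\<close> in auto)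
      also have "\<dots> = lab (f e)"
        using \<omega> f[OF e] by (auto simp: mixed_dimer_covers_def)
      finally show ?thesis .
    qed
    then show "\<omega> \<in> (\<Pi>\<^sub>E e\<in>E. {..lab (f e)})"
      using \<omega> by (auto simp: mixed_dimer_covers_def PiE_iff)
  qed
  moreover have "finite (\<Pi>\<^sub>E e\<in>E. {..lab (f e)})"
    using \<open>finite E\<close> by (intro finite_PiE) auto
  ultimately show ?thesis by (rule finite_subset)
qed

type_synonym point = "nat \<times> nat"

text \<open>Tiles are numbered from 1; tile 0 is junk.\<close>

definition tile_corner :: "nat \<Rightarrow> point" where
  "tile_corner k = (let j = k div 2 in if odd k then (j, j) else (j - 1, j))"

definition bottom_edge :: "nat \<Rightarrow> point set" where
  "bottom_edge k = (let (x, y) = tile_corner k in {(x, y), (x + 1, y)})"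

definition top_edge :: "nat \<Rightarrow> point set" where
  "top_edge k = (let (x, y) = tile_corner k in {(x, y + 1), (x + 1, y + 1)})"

definition left_edge :: "nat \<Rightarrow> point set" where
  "left_edge k = (let (x, y) = tile_corner k in {(x, y), (x, y + 1)})"

definition right_edge :: "nat \<Rightarrow> point set" where
  "right_edge k = (let (x, y) = tile_corner k in {(x + 1, y), (x + 1, y + 1)})"

definition tile_edges :: "nat \<Rightarrow> point set set" where
  "tile_edges k = {bottom_edge k, top_edge k, left_edge k, right_edge k}"

definition zigzag_edges :: "nat \<Rightarrow> point set set" where
  "zigzag_edges n = (\<Union>k\<in>{1..n}. tile_edges k)"

definition zigzag_vertices :: "nat \<Rightarrow> point set" where
  "zigzag_vertices n = \<Union> (zigzag_edges n)"

definition base_pair :: "nat \<Rightarrow> point set" where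
  "base_pair k = (let j = k div 2 in if odd k then {(j, j), (j + 1, j)} else {(j - 1, j), (j - 1, j + 1)})"

definition vertex_pair :: "nat \<Rightarrow> nat \<Rightarrow> point set" where
  "vertex_pair n i =
     (if i < n then base_pair (i + 1) else zigzag_vertices n - (\<Union>k\<in>{1..n}. base_pair k))"

definition zigzag_labeling :: "nat \<Rightarrow> (nat \<Rightarrow> nat) \<Rightarrow> point \<Rightarrow> nat" where
  "zigzag_labeling n x v = x (THE i. i \<le> n \<and> v \<in> vertex_pair n i)"

lemma ex1_vertex_pair:
  assumes "v \<in> zigzag_vertices n"
  shows "\<exists>!i. i \<le> n \<and> v \<in> vertex_pair n i"
proof -
  have disj: "k = l" if "v \<in> base_pair k" "v \<in> base_pair l" "k \<ge> 1" "l \<ge> 1" for k l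
    using that by (auto simp: base_pair_def Let_def elim!: oddE evenE split: if_splits)
  show ?thesis
  proof (cases "\<exists>k\<in>{1..n}. v \<in> base_pair k")
    case True
    then obtain k where k: "1 \<le> k" "k \<le> n" "v \<in> base_pair k" by auto
    show ?thesis
    proof (rule ex1I[of _ "k - 1"])
      show "k - 1 \<le> n \<and> v \<in> vertex_pair n (k - 1)" using k by (auto simp: vertex_pair_def)
    next
      fix i assume i: "i \<le> n \<and> v \<in> vertex_pair n i"
      then have "i < n" using k by (auto simp: vertex_pair_def split: if_splits)
      then have "v \<in> base_pair (i + 1)" using i by (simp add: vertex_pair_def)
      from disj[OF this k(3)] k show "i = k - 1" by simp
    qed
  next
    case False
    then have "v \<in> vertex_pair n n" using assms by (auto simp: vertex_pair_def)
    moreover have "i = n" if "i \<le> n" "v \<in> vertex_pair n i" for i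
      using that False by (auto simp: vertex_pair_def split: if_splits)
    ultimately show ?thesis by blast
  qed
qed

definition a_edge :: "nat \<Rightarrow> point set" where
  "a_edge k = (if k = 0 then left_edge 1 else if odd k then top_edge k else right_edge k)"

definition b_edge :: "nat \<Rightarrow> point set" where
  "b_edge k = (if odd k then bottom_edge k else left_edge k)"

definition c_edge :: "nat \<Rightarrow> point set" where
  "c_edge k = (if odd k then right_edge k else top_edge k)"

text \<open>The next two facts justify the closed form of \<^const>\<open>a_edge\<close>: for positive \<open>k\<close> it is the
  edge shared by tiles \<open>k\<close> and \<open>k + 1\<close>, and it is the edge of tile \<open>k\<close> that remains after
  \<open>a_edge (k - 1)\<close>, \<open>b_edge k\<close> and \<open>c_edge k\<close>.\<close>

lemmas edge_defs = bottom_edge_def top_edge_def left_edge_def right_edge_def tile_corner_def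

lemma tile_edges_inter:
  assumes "k \<ge> 1" shows "tile_edges k \<inter> tile_edges (k + 1) = {a_edge k}"
proof (cases "odd k")
  case True
  then obtain j where "k = 2 * j + 1" by (elim oddE)
  then show ?thesis by (auto simp: tile_edges_def a_edge_def edge_defs Let_def doubleton_eq_iff)
next
  case False
  then obtain j where "k = 2 * j" by auto
  with assms obtain l where "k = 2 * Suc l" by (cases j) auto
  then show ?thesis by (auto simp: tile_edges_def a_edge_def edge_defs Let_def doubleton_eq_iff)
qed

lemma tile_edges_eq:
  assumes "k \<ge> 1" shows "tile_edges k = {a_edge (k - 1), b_edge k, c_edge k, a_edge k}"
proof (cases "odd k")
  case True
  then obtain j where "k = 2 * j + 1" by (elim oddE)
  then show ?thesis
    by (cases j) (auto simp: tile_edges_def a_edge_def b_edge_def c_edge_def edge_defs Let_def)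
next
  case False
  then obtain j where "k = 2 * j" by auto
  with assms obtain l where "k = 2 * Suc l" by (cases j) auto
  then show ?thesis
    by (auto simp: tile_edges_def a_edge_def b_edge_def c_edge_def edge_defs Let_def)
qed

lemma a_b_c_edge_distinct:
  "inj a_edge" "inj_on b_edge {1..}" "inj_on c_edge {1..}"
  "k \<ge> 1 \<Longrightarrow> a_edge l \<noteq> b_edge k" "k \<ge> 1 \<Longrightarrow> a_edge l \<noteq> c_edge k"
  "k \<ge> 1 \<Longrightarrow> l \<ge> 1 \<Longrightarrow> b_edge l \<noteq> c_edge k"
proof -
  have a: "a_edge k = (if odd k then {(k div 2, k div 2 + 1), (k div 2 + 1, k div 2 + 1)}
      else {(k div 2, k div 2), (k div 2, k div 2 + 1)})" for k
    by (auto simp: a_edge_def edge_defs Let_def elim!: evenE)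
  note bc = b_edge_def c_edge_def edge_defs Let_def
  show "inj a_edge"
    by (intro injI) (auto simp: a doubleton_eq_iff elim!: oddE evenE split: if_splits)
  show "inj_on b_edge {1..}" "inj_on c_edge {1..}"
    by (intro inj_onI; auto simp: bc doubleton_eq_iff elim!: oddE evenE split: if_splits)+
  show "a_edge l \<noteq> b_edge k" "a_edge l \<noteq> c_edge k" if "k \<ge> 1"
    using that by (auto simp: a bc doubleton_eq_iff elim!: oddE evenE split: if_splits)
  show "b_edge l \<noteq> c_edge k" if "k \<ge> 1" "l \<ge> 1"
    using that by (auto simp: bc doubleton_eq_iff elim!: oddE evenE split: if_splits)
qed

text \<open>Matrices are indexed from 0 in the library; \<open>mat1\<close> takes the entry function in 1-based indices.\<close>

definition mat1 :: "nat \<Rightarrow> nat \<Rightarrow> (nat \<Rightarrow> nat \<Rightarrow> 'a) \<Rightarrow> 'a mat" where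
  "mat1 r s f = mat r s (\<lambda>(i, j). f (i + 1) (j + 1))"

definition U_mat :: "nat \<Rightarrow> 'a::field \<Rightarrow> 'a mat" where
  "U_mat N t = mat1 (N + 1) (N + 1) (\<lambda>i j. if i + j \<le> N + 2 then t ^ (N + 2 - i - j) else 0)"

definition T_mat :: "nat \<Rightarrow> nat \<Rightarrow> 'a::field \<Rightarrow> 'a mat" where
  "T_mat p q t = mat1 (p + 1) (q + 1) (\<lambda>i j. if i = j then t ^ (i - 1) else 0)"

definition W_mat :: "nat \<Rightarrow> 'a::field \<Rightarrow> 'a mat" where
  "W_mat N t = mat1 (N + 1) (N + 1) (\<lambda>i j. if j = N + 2 - i then t ^ N else 0)"

text \<open>The left fold multiplies the factors for \<open>k = 2, \<dots>, n\<close> on the right, in increasing order.\<close>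

definition X_mat ::
    "nat \<Rightarrow> (nat \<Rightarrow> nat) \<Rightarrow> (nat \<Rightarrow> 'a::field) \<Rightarrow> (nat \<Rightarrow> 'a) \<Rightarrow> (nat \<Rightarrow> 'a) \<Rightarrow> 'a mat" where
  "X_mat n m a b c =
     foldl (\<lambda>A k. A * (W_mat (m (k - 1)) (b k)
                       * T_mat (m (k - 1)) (m k) (inverse (b k) * c k) * U_mat (m k) (a k)))
       (U_mat (m 0) (b 1) * T_mat (m 0) (m 1) (a 0 * c 1) * U_mat (m 1) (a 1))
       [2..<n + 1]"

lemma X_mat_carrier:
  assumes "n \<ge> 1" shows "X_mat n m a b c \<in> carrier_mat (m 0 + 1) (m n + 1)"
  using assms
proof (induction n rule: dec_induct)
  case base
  then show ?case by (intro carrier_matI) (simp_all add: X_mat_def U_mat_def mat1_def)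
next
  case (step n)
  have "X_mat (Suc n) m a b c = X_mat n m a b c *
      (W_mat (m n) (b (Suc n)) * T_mat (m n) (m (Suc n)) (inverse (b (Suc n)) * c (Suc n))
        * U_mat (m (Suc n)) (a (Suc n)))"
    using step.hyps by (simp add: X_mat_def)
  with step.IH show ?case by (intro carrier_matI) (simp_all add: U_mat_def mat1_def)
qed

end

theory Submission
  imports Defs
begin

text \<open>Removing the last tile from the snake graph gives a recursion: if \<open>\<omega>\<close> is a cover of the snake
  with \<open>n + 1\<close> tiles, then \<open>g = \<omega>(c\<^sub>n\<^sub>+\<^sub>1)\<close> determines the values of \<open>\<omega>\<close> on the two other new edges, and
  \<open>\<omega>\<close> restricts to a cover of the first \<open>n\<close> tiles in which both vertices of the last pair are labelled
  \<open>g\<close>. Multiplying the matrix \<open>X\<close> by its last three factors is the same recursion, where \<open>g\<close> is the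
  row index of the last factor \<open>U\<close>.\<close>

section \<open>Vertices and edges of the zigzag snake\<close>

text \<open>The staircase (0,0), (0,1), (1,1), (1,2), ... traced by the a-edges.\<close>

definition spine :: "nat \<Rightarrow> point" where
  "spine k = (k div 2, (k + 1) div 2)"

text \<open>The corner of tile \<open>k + 1\<close> off the staircase; its other corners are
  \<open>spine k\<close>, \<open>spine (k + 1)\<close> and \<open>spine (k + 2)\<close>.\<close>

definition tip :: "nat \<Rightarrow> point" where
  "tip k = (if even k then (k div 2 + 1, k div 2) else (k div 2, k div 2 + 2))"

lemma spine_eq_iff [simp]: "spine k = spine l \<longleftrightarrow> k = l"
proof
  assume "spine k = spine l"
  \<comment> \<open>The coordinates of \<open>spine i\<close> add up to \<open>i\<close>.\<close>
  moreover have "i = i div 2 + (i + 1) div 2" for i :: nat by linarith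
  ultimately show "k = l" by (metis spine_def prod.inject)
qed simp

lemma tip_eq_iff [simp]: "tip k = tip l \<longleftrightarrow> k = l"
  by (cases "even k"; cases "even l") (auto simp: tip_def elim!: oddE evenE, presburger+)

text \<open>The staircase lies on the diagonals y = x and y = x + 1, the tips on y = x - 1 and y = x
  + 2.\<close>

lemma spine_neq_tip [simp]: "spine k \<noteq> tip l" "tip l \<noteq> spine k"
  by (cases "even k"; cases "even l"; auto simp: tip_def spine_def elim!: oddE evenE)+

lemma a_edge_eq: "a_edge k = {spine k, spine (k + 1)}"
  by (auto simp: a_edge_def edge_defs Let_def spine_def elim!: oddE evenE)

lemma b_edge_eq: "b_edge (Suc k) = {spine k, tip k}"
  by (auto simp: b_edge_def edge_defs Let_def spine_def tip_def elim!: oddE evenE)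

lemma c_edge_eq: "c_edge (Suc k) = {tip k, spine (k + 2)}"
  by (auto simp: c_edge_def edge_defs Let_def spine_def tip_def elim!: oddE evenE)

text \<open>By \<open>b_edge_eq\<close>, every pair but the last consists of the endpoints of a
  b-edge.\<close>

lemma base_pair_eq: "base_pair (Suc k) = {spine k, tip k}"
  by (auto simp: base_pair_def Let_def spine_def tip_def elim!: oddE evenE)

text \<open>In contrast to \<^const>\<open>zigzag_edges\<close>, the snake without tiles still has the edge \<open>a_edge 0\<close>, so that
  the recursion can start there.\<close>

fun snake_edges :: "nat \<Rightarrow> point set set" where
  "snake_edges 0 = {a_edge 0}"
| "snake_edges (Suc n) =
     insert (a_edge (Suc n)) (insert (b_edge (Suc n)) (insert (c_edge (Suc n)) (snake_edges n)))"

lemma finite_snake_edges [simp]: "finite (snake_edges n)"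
  by (induction n) auto

lemma zigzag_edges_eq:
  assumes "n \<ge> 1"
  shows "zigzag_edges n = snake_edges n"
  using assms
proof (induction n rule: dec_induct)
  case base
  show ?case using tile_edges_eq[of 1] by (auto simp: zigzag_edges_def)
next
  case (step n)
  have "a_edge n \<in> snake_edges n" by (cases n) auto
  moreover have "zigzag_edges (Suc n) = tile_edges (Suc n) \<union> zigzag_edges n"
    by (simp add: zigzag_edges_def atLeastAtMostSuc_conv)
  ultimately show ?case using step.IH tile_edges_eq[of "Suc n"] by auto
qed

lemma Union_snake_edges: "\<Union> (snake_edges n) = spine ` {..n + 1} \<union> tip ` {..<n}"
proof (induction n)
  case 0
  show ?case by (auto simp: a_edge_eq atMost_Suc)
next
  case (Suc n)
  show ?case
    by (simp add: Suc.IH a_edge_eq b_edge_eq c_edge_eq atMost_Suc lessThan_Suc) auto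
qed

lemma new_edges_distinct:
  "a_edge (Suc n) \<noteq> b_edge (Suc n)" "a_edge (Suc n) \<noteq> c_edge (Suc n)"
  "b_edge (Suc n) \<noteq> c_edge (Suc n)"
  by (auto simp: a_edge_eq b_edge_eq c_edge_eq doubleton_eq_iff)

text \<open>Each new edge has an endpoint on no old edge: \<open>spine (n + 2)\<close> for the a-
  and c-edge, \<open>tip n\<close> for the b-edge.\<close>

lemma new_edges_notin:
  "a_edge (Suc n) \<notin> snake_edges n" "b_edge (Suc n) \<notin> snake_edges n"
  "c_edge (Suc n) \<notin> snake_edges n"
proof -
  have new: "e \<notin> snake_edges n" if "v \<in> e" "v \<notin> \<Union> (snake_edges n)" for e v
    using that by blast
  show "a_edge (Suc n) \<notin> snake_edges n" "c_edge (Suc n) \<notin> snake_edges n"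
    by (rule new[of "spine (n + 2)"]; auto simp: a_edge_eq c_edge_eq Union_snake_edges)+
  show "b_edge (Suc n) \<notin> snake_edges n"
    by (rule new[of "tip n"]) (auto simp: b_edge_eq Union_snake_edges)
qed

section \<open>Covers of the zigzag snake\<close>

text \<open>With the incidence condition inside the summand, the sum splits directly when edges are
  inserted.\<close>

definition cover_degree :: "nat \<Rightarrow> (point set \<Rightarrow> nat) \<Rightarrow> point \<Rightarrow> nat" where
  "cover_degree n \<omega> v = (\<Sum>e\<in>snake_edges n. if v \<in> e then \<omega> e else 0)"

lemma cover_degree_Suc:
  "cover_degree (Suc n) \<omega> v = cover_degree n \<omega> v + (if v \<in> a_edge (Suc n) then \<omega> (a_edge (Suc n)) else 0)
     + (if v \<in> b_edge (Suc n) then \<omega> (b_edge (Suc n)) else 0)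
     + (if v \<in> c_edge (Suc n) then \<omega> (c_edge (Suc n)) else 0)"
  unfolding cover_degree_def using new_edges_distinct[of n] new_edges_notin[of n] by simp

lemma cover_degree_eq_0:
  "v \<notin> \<Union> (snake_edges n) \<Longrightarrow> cover_degree n \<omega> v = 0"
  unfolding cover_degree_def by (intro sum.neutral) auto

lemma cover_degree_cong:
  "(\<And>e. e \<in> snake_edges n \<Longrightarrow> \<omega> e = \<omega>' e) \<Longrightarrow> cover_degree n \<omega> v = cover_degree n \<omega>' v"
  unfolding cover_degree_def by (intro sum.cong) auto

text \<open>The index \<open>min k n\<close> puts the last label on both \<open>spine n\<close> and
  \<open>spine (n + 1)\<close>.\<close>

definition snake_covers :: "nat \<Rightarrow> (nat \<Rightarrow> nat) \<Rightarrow> (point set \<Rightarrow> nat) set" where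
  "snake_covers n y =
     {\<omega> \<in> snake_edges n \<rightarrow>\<^sub>E UNIV. (\<forall>k\<le>n + 1. cover_degree n \<omega> (spine k) = y (min k n)) \<and>
        (\<forall>k<n. cover_degree n \<omega> (tip k) = y k)}"

lemma zigzag_labeling_eqI:
  assumes "v \<in> zigzag_vertices n" "i \<le> n" "v \<in> vertex_pair n i"
  shows "zigzag_labeling n y v = y i"
  unfolding zigzag_labeling_def
  using the1_equality[OF ex1_vertex_pair[OF assms(1)], of i] assms(2,3) by simp

lemma mixed_dimer_covers_zigzag:
  assumes "n \<ge> 1"
  shows "mixed_dimer_covers (zigzag_vertices n) (zigzag_edges n) (zigzag_labeling n y) = snake_covers n y"
proof -
  have V: "zigzag_vertices n = spine ` {..n + 1} \<union> tip ` {..<n}"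
    unfolding zigzag_vertices_def zigzag_edges_eq[OF assms] Union_snake_edges ..
  have base: "(\<Union>k\<in>{1..n}. base_pair k) = spine ` {..<n} \<union> tip ` {..<n}"
  proof -
    have "(\<Union>k\<in>{1..n}. base_pair k) = (\<Union>k\<in>{..<n}. base_pair (Suc k))"
      using image_Suc_lessThan[of n] by (metis image_image)
    then show ?thesis by (auto simp: base_pair_eq)
  qed
  \<comment> \<open>Removing the base pairs leaves exactly \<open>spine n\<close> and
    \<open>spine (n + 1)\<close> for the last pair.\<close>
  have "spine k \<in> vertex_pair n (min k n)" if "k \<le> n + 1" for k
    using that unfolding vertex_pair_def base V by (auto simp: base_pair_eq)
  then have spine_label: "zigzag_labeling n y (spine k) = y (min k n)" if "k \<le> n + 1" for k
    using that by (intro zigzag_labeling_eqI) (auto simp: V)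
  have tip_label: "zigzag_labeling n y (tip k) = y k" if "k < n" for k
    using that by (intro zigzag_labeling_eqI) (auto simp: V vertex_pair_def base_pair_eq)
  have deg: "(\<Sum>e\<in>{e \<in> snake_edges n. v \<in> e}. \<omega> e) = cover_degree n \<omega> v" for \<omega> v
    unfolding cover_degree_def by (simp add: sum.If_cases Collect_conj_eq Int_commute)
  show ?thesis
    unfolding mixed_dimer_covers_def snake_covers_def zigzag_edges_eq[OF assms] deg V
    using spine_label tip_label by auto
qed

lemma snake_covers_cong:
  "(\<And>k. k \<le> n \<Longrightarrow> y k = z k) \<Longrightarrow> snake_covers n y = snake_covers n z"
  unfolding snake_covers_def by auto

lemma snake_covers_0:
  "snake_covers 0 y = {\<lambda>e. if e = a_edge 0 then y 0 else undefined}"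
proof -
  have "(\<forall>k\<le>Suc 0. cover_degree 0 \<omega> (spine k) = y 0) \<longleftrightarrow> \<omega> (a_edge 0) = y 0" for \<omega>
    by (auto simp: cover_degree_def a_edge_eq le_Suc_eq)
  then show ?thesis
    by (auto simp: snake_covers_def PiE_iff extensional_def fun_eq_iff split: if_splits)
qed

text \<open>Let a, b, c be the values on the new edges. The new vertices \<open>tip n\<close> and
  \<open>spine (n + 2)\<close> demand b + c = \<open>y n\<close> and a + c =
  \<open>y (Suc n)\<close>. At \<open>spine n\<close> and \<open>spine (n + 1)\<close> the old
  degree must then be \<open>y n\<close> - b and \<open>y (Suc n)\<close> - a, both equal to
  c.\<close>

lemma snake_covers_Suc_iff:
  "\<omega> \<in> snake_covers (Suc n) y \<longleftrightarrow>
     \<omega> \<in> snake_edges (Suc n) \<rightarrow>\<^sub>E UNIV \<and>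
     \<omega> (b_edge (Suc n)) + \<omega> (c_edge (Suc n)) = y n \<and>
     \<omega> (a_edge (Suc n)) + \<omega> (c_edge (Suc n)) = y (Suc n) \<and>
     restrict \<omega> (snake_edges n) \<in> snake_covers n (y(n := \<omega> (c_edge (Suc n))))"
proof -
  let ?d = "cover_degree n \<omega>"
  let ?a = "\<omega> (a_edge (Suc n))" and ?b = "\<omega> (b_edge (Suc n))" and ?c = "\<omega> (c_edge (Suc n))"
  have spine_deg: "cover_degree (Suc n) \<omega> (spine k) = ?d (spine k) + (if k = n then ?b else 0)
      + (if k = n + 1 then ?a else 0) + (if k = n + 2 then ?a + ?c else 0)" for k
    by (simp add: cover_degree_Suc a_edge_eq b_edge_eq c_edge_eq)
  have tip_deg: "cover_degree (Suc n) \<omega> (tip k) = ?d (tip k) + (if k = n then ?b + ?c else 0)" for k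
    by (simp add: cover_degree_Suc a_edge_eq b_edge_eq c_edge_eq)
  have zero: "?d (spine (Suc (Suc n))) = 0" "?d (tip n) = 0"
    by (rule cover_degree_eq_0; auto simp: Union_snake_edges)+
  have restr: "cover_degree n (restrict \<omega> (snake_edges n)) v = ?d v" for v
    by (rule cover_degree_cong) simp
  have old: "(\<forall>k<n. min k (Suc n) = k) \<and> (\<forall>k<n. min k n = k)" by auto
  \<comment> \<open>The conditions with index below \<open>n\<close> are common to both snakes, so
    only the boundary vertices are split off.\<close>
  have split: "(\<forall>k\<le>n + 1. P k) \<longleftrightarrow> (\<forall>k<n. P k) \<and> P n \<and> P (Suc n)" for P :: "nat \<Rightarrow> bool"
    by (auto simp: le_less less_Suc_eq)
  have split': "(\<forall>k\<le>Suc n + 1. P k) \<longleftrightarrow> (\<forall>k<n. P k) \<and> P n \<and> P (Suc n) \<and> P (Suc (Suc n))"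
    for P :: "nat \<Rightarrow> bool"
    by (auto simp: le_less less_Suc_eq)
  have lt: "(\<forall>k<Suc n. P k) \<longleftrightarrow> (\<forall>k<n. P k) \<and> P n" for P :: "nat \<Rightarrow> bool"
    by (auto simp: less_Suc_eq)
  show ?thesis
    unfolding snake_covers_def mem_Collect_eq spine_deg tip_deg restr split split' lt
    using old zero by (auto simp del: snake_edges.simps)
qed

section \<open>Weighted sums over covers and their recursion\<close>

definition cover_sum :: "nat \<Rightarrow> (point set \<Rightarrow> 'a::comm_semiring_1) \<Rightarrow> (nat \<Rightarrow> nat) \<Rightarrow> 'a" where
  "cover_sum n w y = (\<Sum>\<omega>\<in>snake_covers n y. cover_weight (snake_edges n) w \<omega>)"

lemma cover_sum_0: "cover_sum 0 w y = w (a_edge 0) ^ y 0"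
  by (simp add: cover_sum_def snake_covers_0 cover_weight_def)

text \<open>The value on the new c-edge and the restriction to the old edges determine a cover, and
  that value is at most \<open>y n\<close>.\<close>

lemma finite_snake_covers: "finite (snake_covers n y)"
proof (induction n arbitrary: y)
  case 0
  show ?case by (simp add: snake_covers_0)
next
  case (Suc n)
  let ?E = "snake_edges n" and ?c = "c_edge (Suc n)"
  let ?f = "\<lambda>\<omega>. (\<omega> ?c, restrict \<omega> ?E)"
  have "inj_on ?f (snake_covers (Suc n) y)"
  proof (rule inj_onI)
    fix \<omega> \<omega>' :: "point set \<Rightarrow> nat"
    assume *: "\<omega> \<in> snake_covers (Suc n) y" "\<omega>' \<in> snake_covers (Suc n) y" and eq: "?f \<omega> = ?f \<omega>'"
    have "\<omega> e = \<omega>' e" if "e \<in> snake_edges (Suc n)" for e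
    proof -
      have "\<omega> e = \<omega>' e" if "e \<in> ?E"
        using eq that by (metis prod.inject restrict_apply')
      then show ?thesis using that * eq by (auto simp: snake_covers_Suc_iff)
    qed
    moreover have "\<omega> \<in> snake_edges (Suc n) \<rightarrow>\<^sub>E UNIV" "\<omega>' \<in> snake_edges (Suc n) \<rightarrow>\<^sub>E UNIV"
      using * by (auto simp only: snake_covers_Suc_iff)
    ultimately show "\<omega> = \<omega>'" by (metis PiE_ext)
  qed
  moreover have "?f ` snake_covers (Suc n) y \<subseteq> (SIGMA g:{..y n}. snake_covers n (y(n := g)))"
    by (auto simp: snake_covers_Suc_iff)
  moreover have "finite (SIGMA g:{..y n}. snake_covers n (y(n := g)))"
    using Suc.IH by auto
  ultimately show ?case by (rule inj_on_finite)
qed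

lemma cover_weight_snake_Suc:
  "cover_weight (snake_edges (Suc n)) w \<omega> =
     cover_weight (snake_edges n) w (restrict \<omega> (snake_edges n))
     * w (b_edge (Suc n)) ^ \<omega> (b_edge (Suc n)) * w (c_edge (Suc n)) ^ \<omega> (c_edge (Suc n))
     * w (a_edge (Suc n)) ^ \<omega> (a_edge (Suc n))"
proof -
  have "cover_weight (snake_edges n) w (restrict \<omega> (snake_edges n)) = cover_weight (snake_edges n) w \<omega>"
    unfolding cover_weight_def by (rule prod.cong) auto
  then show ?thesis
    using new_edges_distinct[of n] new_edges_notin[of n]
    by (simp add: cover_weight_def ac_simps)
qed

text \<open>Covers are sorted by their value \<open>g\<close> on the new c-edge. Both degree
  equations bound \<open>g\<close>, so the truncated differences in the exponents are exact.\<close>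

lemma cover_sum_Suc:
  "cover_sum (Suc n) w y = (\<Sum>g\<le>min (y n) (y (Suc n)). cover_sum n w (y(n := g))
     * w (b_edge (Suc n)) ^ (y n - g) * w (c_edge (Suc n)) ^ g * w (a_edge (Suc n)) ^ (y (Suc n) - g))"
proof -
  let ?E = "snake_edges n"
  let ?a = "a_edge (Suc n)" and ?b = "b_edge (Suc n)" and ?c = "c_edge (Suc n)"
  let ?S = "SIGMA g:{..min (y n) (y (Suc n))}. snake_covers n (y(n := g))"
  \<comment> \<open>Inverse of the map taking a cover to its value on the c-edge and its
    restriction; the degree equations force the other two values.\<close>
  define extend where "extend = (\<lambda>(g, \<omega>). \<omega>(?a := y (Suc n) - g, ?b := y n - g, ?c := g))"
  have ext: "extend (g, \<omega>) ?a = y (Suc n) - g" "extend (g, \<omega>) ?b = y n - g" "extend (g, \<omega>) ?c = g" for g \<omega>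
    using new_edges_distinct[of n] by (simp_all add: extend_def)
  have restr: "restrict (extend (g, \<omega>)) ?E = \<omega>" if "\<omega> \<in> snake_covers n z" for g \<omega> z
  proof
    fix e
    \<comment> \<open>Off the old edges both sides are \<open>undefined\<close>, so the three
      updates leave no trace.\<close>
    have "\<omega> \<in> extensional ?E" using that by (simp add: snake_covers_def PiE_iff)
    then show "restrict (extend (g, \<omega>)) ?E e = \<omega> e"
      using new_edges_notin[of n] by (auto simp: extend_def restrict_def extensional_def)
  qed
  have "cover_sum (Suc n) w y =
      (\<Sum>(g, \<omega>)\<in>?S. cover_weight ?E w \<omega> * w ?b ^ (y n - g) * w ?c ^ g * w ?a ^ (y (Suc n) - g))"
    unfolding cover_sum_def
  proof (rule sum.reindex_bij_witness[where j = "\<lambda>\<omega>. (\<omega> ?c, restrict \<omega> ?E)" and i = extend])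
    fix \<omega> assume \<omega>: "\<omega> \<in> snake_covers (Suc n) y"
    then have val: "\<omega> ?a = y (Suc n) - \<omega> ?c" "\<omega> ?b = y n - \<omega> ?c"
      and le: "\<omega> ?c \<le> y n" "\<omega> ?c \<le> y (Suc n)"
      and PiE: "\<omega> \<in> snake_edges (Suc n) \<rightarrow>\<^sub>E UNIV"
      by (auto simp only: snake_covers_Suc_iff)
    show "extend (\<omega> ?c, restrict \<omega> ?E) = \<omega>"
      using val PiE by (auto simp: extend_def fun_eq_iff restrict_def PiE_iff extensional_def)
    show "(\<omega> ?c, restrict \<omega> ?E) \<in> ?S"
      using \<omega> le by (auto simp only: snake_covers_Suc_iff mem_Sigma_iff atMost_iff min.bounded_iff)
    show "(case (\<omega> ?c, restrict \<omega> ?E) of (g, \<omega>) \<Rightarrow>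
        cover_weight ?E w \<omega> * w ?b ^ (y n - g) * w ?c ^ g * w ?a ^ (y (Suc n) - g)) =
      cover_weight (snake_edges (Suc n)) w \<omega>"
      by (simp only: prod.case cover_weight_snake_Suc val)
  next
    fix p assume "p \<in> ?S"
    then obtain g \<omega> where p: "p = (g, \<omega>)" "g \<le> y n" "g \<le> y (Suc n)" "\<omega> \<in> snake_covers n (y(n := g))"
      by auto
    show "(extend p ?c, restrict (extend p) ?E) = p"
      using restr[OF p(4)] by (simp add: p(1) ext)
    have "extend p \<in> snake_edges (Suc n) \<rightarrow>\<^sub>E UNIV"
      using p(4) by (auto simp: extend_def p(1) snake_covers_def PiE_iff extensional_def)
    then show "extend p \<in> snake_covers (Suc n) y"
      using p restr[OF p(4)] by (simp add: snake_covers_Suc_iff ext del: snake_edges.simps)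
  qed
  also have "\<dots> = (\<Sum>g\<le>min (y n) (y (Suc n)). \<Sum>\<omega>\<in>snake_covers n (y(n := g)).
      cover_weight ?E w \<omega> * w ?b ^ (y n - g) * w ?c ^ g * w ?a ^ (y (Suc n) - g))"
    by (rule sum.Sigma[symmetric]) (simp_all add: finite_snake_covers)
  finally show ?thesis
    by (simp add: cover_sum_def sum_distrib_right)
qed

section \<open>Entries of the matrix product\<close>

lemma U_mat_index:
  "p \<le> N \<Longrightarrow> q \<le> N \<Longrightarrow> U_mat N t $$ (p, q) = (if p + q \<le> N then t ^ (N - p - q) else 0)"
  by (simp add: U_mat_def mat1_def)

text \<open>Right multiplication by the rectangular diagonal matrix scales column \<open>l\<close>
  by \<open>t ^ l\<close> and cuts off columns or pads with zero columns.\<close>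

lemma mat_mult_T_index:
  assumes "A \<in> carrier_mat r (N + 1)" "p < r" "l \<le> M"
  shows "(A * T_mat N M t) $$ (p, l) = (if l \<le> N then A $$ (p, l) * t ^ l else 0)"
proof -
  have "(A * T_mat N M t) $$ (p, l) = (\<Sum>k<Suc N. A $$ (p, k) * (if k = l then t ^ k else 0))"
    using assms
    by (auto simp: T_mat_def mat1_def scalar_prod_def atLeast0LessThan intro!: sum.cong)
  also have "\<dots> = (\<Sum>k<Suc N. if k = l then A $$ (p, k) * t ^ k else 0)"
    by (intro sum.cong) auto
  finally show ?thesis by simp
qed

text \<open>Right multiplication by the antidiagonal matrix reverses the order of the
  columns.\<close>

lemma mat_mult_W_index:
  assumes "A \<in> carrier_mat r (N + 1)" "p < r" "l \<le> N"
  shows "(A * W_mat N t) $$ (p, l) = A $$ (p, N - l) * t ^ N"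
proof -
  have "(A * W_mat N t) $$ (p, l) = (\<Sum>k<Suc N. A $$ (p, k) * (if l = N - k then t ^ N else 0))"
    using assms
    by (auto simp: W_mat_def mat1_def scalar_prod_def atLeast0LessThan Suc_diff_le intro!: sum.cong)
  also have "\<dots> = (\<Sum>k<Suc N. if k = N - l then A $$ (p, k) * t ^ N else 0)"
    using assms(3) by (intro sum.cong) auto
  finally show ?thesis by (simp add: less_Suc_eq_le)
qed

lemma mat_mult_TU_index:
  assumes A: "A \<in> carrier_mat r (N + 1)" and "p < r" "q \<le> M"
  shows "(A * T_mat N M t * U_mat M s) $$ (p, q) =
    (\<Sum>g\<le>min N (M - q). A $$ (p, g) * t ^ g * s ^ (M - q - g))"
proof -
  have "(A * T_mat N M t * U_mat M s) $$ (p, q) =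
      (\<Sum>g<Suc M. (A * T_mat N M t) $$ (p, g) * U_mat M s $$ (g, q))"
    using assms by (simp add: T_mat_def U_mat_def mat1_def scalar_prod_def atLeast0LessThan)
  \<comment> \<open>The T factor kills \<open>g > N\<close>, and the U factor kills
    \<open>g + q > M\<close>.\<close>
  also have "\<dots> = (\<Sum>g<Suc M. if g \<le> min N (M - q) then A $$ (p, g) * t ^ g * s ^ (M - q - g) else 0)"
    using assms by (intro sum.cong refl) (auto simp: mat_mult_T_index[OF A] U_mat_index add.commute)
  also have "\<dots> = (\<Sum>g\<le>min N (M - q). A $$ (p, g) * t ^ g * s ^ (M - q - g))"
    by (rule sum.mono_neutral_cong_right) auto
  finally show ?thesis .
qed

lemma X_mat_1_index:
  assumes "p \<le> m 0" "q \<le> m 1"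
  shows "X_mat 1 m a b c $$ (p, q) =
    (\<Sum>g\<le>min (m 0 - p) (m 1 - q). a 0 ^ g * b 1 ^ (m 0 - p - g) * c 1 ^ g * a 1 ^ (m 1 - q - g))"
proof -
  have "X_mat 1 m a b c $$ (p, q) =
      (\<Sum>g\<le>min (m 0) (m 1 - q). U_mat (m 0) (b 1) $$ (p, g) * (a 0 * c 1) ^ g * a 1 ^ (m 1 - q - g))"
    using mat_mult_TU_index[of "U_mat (m 0) (b 1)" "m 0 + 1" "m 0"] assms
    by (simp add: X_mat_def U_mat_def mat1_def)
  \<comment> \<open>The first U factor vanishes once \<open>p + g\<close> exceeds
    \<open>m 0\<close>, which shrinks the range.\<close>
  also have "\<dots> = (\<Sum>g\<le>min (m 0 - p) (m 1 - q).
      a 0 ^ g * b 1 ^ (m 0 - p - g) * c 1 ^ g * a 1 ^ (m 1 - q - g))"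
    using assms
    by (intro sum.mono_neutral_cong_right) (auto simp: U_mat_index power_mult_distrib le_diff_conv2 add.commute mult_ac)
  finally show ?thesis .
qed

text \<open>The column reversal by W makes the sum run over columns \<open>m n - g\<close>, and
  column \<open>m n - g\<close> stands for last label \<open>g\<close>, as in
  \<open>cover_sum_Suc\<close>.\<close>

lemma X_mat_Suc_index:
  assumes n: "n \<ge> 1" and p: "p \<le> m 0" and q: "q \<le> m (Suc n)" and b: "b (Suc n) \<noteq> 0"
  shows "X_mat (Suc n) m a b c $$ (p, q) =
    (\<Sum>g\<le>min (m n) (m (Suc n) - q). X_mat n m a b c $$ (p, m n - g)
       * b (Suc n) ^ (m n - g) * c (Suc n) ^ g * a (Suc n) ^ (m (Suc n) - q - g))"
proof -
  let ?X = "X_mat n m a b c" and ?W = "W_mat (m n) (b (Suc n))" and ?U = "U_mat (m (Suc n)) (a (Suc n))"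
  let ?t = "inverse (b (Suc n)) * c (Suc n)"
  let ?T = "T_mat (m n) (m (Suc n)) ?t"
  have car: "?X \<in> carrier_mat (m 0 + 1) (m n + 1)" "?W \<in> carrier_mat (m n + 1) (m n + 1)"
    "?T \<in> carrier_mat (m n + 1) (m (Suc n) + 1)" "?U \<in> carrier_mat (m (Suc n) + 1) (m (Suc n) + 1)"
    using X_mat_carrier[OF n] by (auto simp: W_mat_def T_mat_def U_mat_def mat1_def)
  have XW: "?X * ?W \<in> carrier_mat (m 0 + 1) (m n + 1)"
    using car by auto
  have "X_mat (Suc n) m a b c = ?X * (?W * ?T * ?U)"
    using n by (simp add: X_mat_def)
  also have "\<dots> = ?X * ?W * ?T * ?U"
    using car by (simp add: assoc_mult_mat[of _ "m 0 + 1" "m n + 1" _ "m n + 1" _ "m (Suc n) + 1"]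
      assoc_mult_mat[of _ "m 0 + 1" "m n + 1" _ "m (Suc n) + 1" _ "m (Suc n) + 1"]
      assoc_mult_mat[of _ "m n + 1" "m n + 1" _ "m (Suc n) + 1" _ "m (Suc n) + 1"])
  finally have "X_mat (Suc n) m a b c $$ (p, q) =
      (\<Sum>g\<le>min (m n) (m (Suc n) - q). (?X * ?W) $$ (p, g) * ?t ^ g * a (Suc n) ^ (m (Suc n) - q - g))"
    using mat_mult_TU_index[OF XW] p q by simp
  also have "\<dots> = (\<Sum>g\<le>min (m n) (m (Suc n) - q). ?X $$ (p, m n - g)
      * b (Suc n) ^ (m n - g) * c (Suc n) ^ g * a (Suc n) ^ (m (Suc n) - q - g))"
  proof (intro sum.cong refl)
    fix g assume "g \<in> {..min (m n) (m (Suc n) - q)}"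
    then have g: "g \<le> m n" by simp
    \<comment> \<open>The power of b from W absorbs the inverse powers from T; this uses
      \<open>g \<le> m n\<close> and that b is nonzero.\<close>
    have "b (Suc n) ^ m n * ?t ^ g = b (Suc n) ^ (m n - g) * c (Suc n) ^ g"
      using b g by (simp add: power_mult_distrib power_diff power_inverse divide_inverse)
    then show "(?X * ?W) $$ (p, g) * ?t ^ g * a (Suc n) ^ (m (Suc n) - q - g) =
      ?X $$ (p, m n - g) * b (Suc n) ^ (m n - g) * c (Suc n) ^ g * a (Suc n) ^ (m (Suc n) - q - g)"
      using p g by (simp add: mat_mult_W_index[OF car(1)] mult.assoc)
  qed
  finally show ?thesis .
qed

section \<open>Agreement of the two recursions\<close>

lemma X_mat_index_eq_cover_sum:
  assumes "n \<ge> 1" and "p \<le> m 0"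
    and "\<And>k. k \<le> n \<Longrightarrow> w (a_edge k) = a k"
    and "\<And>k. 1 \<le> k \<Longrightarrow> k \<le> n \<Longrightarrow> w (b_edge k) = b k"
    and "\<And>k. 1 \<le> k \<Longrightarrow> k \<le> n \<Longrightarrow> w (c_edge k) = c k"
    and "\<And>k. 2 \<le> k \<Longrightarrow> k \<le> n \<Longrightarrow> b k \<noteq> 0"
    and "q \<le> m n"
  shows "X_mat n m a b c $$ (p, q) = cover_sum n w (m(0 := m 0 - p, n := m n - q))"
  using assms
\<comment> \<open>The column must vary, since the recursion uses all columns
  \<open>m n - g\<close>.\<close>
proof (induction n arbitrary: q rule: dec_induct)
  case base
  \<comment> \<open>The factor \<open>a 0 ^ g\<close> in the first matrix entry is the cover sum of
    the snake without tiles.\<close>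
  then show ?case
    using X_mat_1_index[of p m q a b c] by (simp add: cover_sum_Suc cover_sum_0)
next
  case (step n)
  define y where "y = m(0 := m 0 - p, Suc n := m (Suc n) - q)"
  \<comment> \<open>Since \<open>n \<ge> 1\<close>, the update at 0 does not touch position
    \<open>n\<close>.\<close>
  then have y: "y n = m n" "y (Suc n) = m (Suc n) - q"
    using step.hyps by auto
  have rec: "X_mat n m a b c $$ (p, m n - g) = cover_sum n w (y(n := g))" if "g \<le> m n" for g
  proof -
    \<comment> \<open>The two labelings may differ at \<open>Suc n\<close>, which covers of the
      first \<open>n\<close> tiles do not see.\<close>
    have "snake_covers n (m(0 := m 0 - p, n := g)) = snake_covers n (y(n := g))"
      by (rule snake_covers_cong) (auto simp: y_def)
    then have "cover_sum n w (m(0 := m 0 - p, n := g)) = cover_sum n w (y(n := g))"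
      by (simp only: cover_sum_def)
    moreover have "X_mat n m a b c $$ (p, m n - g) = cover_sum n w (m(0 := m 0 - p, n := m n - (m n - g)))"
      using step.prems by (intro step.IH) auto
    ultimately show ?thesis using that by simp
  qed
  show ?case
    unfolding y_def[symmetric] using step.hyps step.prems rec
    by (simp add: X_mat_Suc_index cover_sum_Suc y)
qed

theorem theorem7:
  fixes n :: nat and m :: "nat \<Rightarrow> nat"
    and a b c :: "nat \<Rightarrow> 'a::field" and w :: "(nat \<times> nat) set \<Rightarrow> 'a"
    and i j :: nat
  assumes "n \<ge> 1"
    and "\<And>k. k \<le> n \<Longrightarrow> w (a_edge k) = a k"
    and "\<And>k. 1 \<le> k \<Longrightarrow> k \<le> n \<Longrightarrow> w (b_edge k) = b k"
    and "\<And>k. 1 \<le> k \<Longrightarrow> k \<le> n \<Longrightarrow> w (c_edge k) = c k"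
    and "\<And>k. 2 \<le> k \<Longrightarrow> k \<le> n \<Longrightarrow> b k \<noteq> 0"
    and "1 \<le> i" and "i \<le> m 0 + 1" and "1 \<le> j" and "j \<le> m n + 1"
  shows "X_mat n m a b c $$ (i - 1, j - 1) =
    (\<Sum>\<omega>\<in>mixed_dimer_covers (zigzag_vertices n) (zigzag_edges n)
            (zigzag_labeling n (m(0 := m 0 + 1 - i, n := m n + 1 - j))).
       cover_weight (zigzag_edges n) w \<omega>)"
proof -
  \<comment> \<open>Passage from 1-based to 0-based indices; \<open>i\<close> and \<open>j\<close>
    are positive, so truncated subtraction is harmless.\<close>
  have "m 0 + 1 - i = m 0 - (i - 1)" "m n + 1 - j = m n - (j - 1)"
    using assms by auto
  then show ?thesis
    using X_mat_index_eq_cover_sum[of n "i - 1" m w a b c "j - 1"] assms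
      mixed_dimer_covers_zigzag[OF \<open>n \<ge> 1\<close>]
    by (simp add: cover_sum_def zigzag_edges_eq)
qed

end
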